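(* (a) Assume that (i) $\sum_{\nu\in\mathbb{N}}\alpha_{\nu,j}^{-1}\nu^{-1/2}<\infty$ for every $j\in\mathbb{N}$ and $\alpha_{\nu,j}\le\alpha_{\nu+1,j}$ for all $\nu,j\in\mathbb{N}$. Then $$\mathfrak{X}\subseteq\bigcap_{\nu\in\mathbb{N}}\ell^{2\nu}(\boldsymbol{\alpha}_\nu^{-1})\subsetneq\mathbb{R}^{\mathbb{N}}.$$ (b) Assume (i) and, additionally, (ii) there exists $j_0\in\mathbb{N}$ such that $\sum_{\nu\in\mathbb{N},\,j\ge j_0}\alpha_{\nu,j}^{-1}<\infty$. Then $$\mu(\mathfrak{X})=1\qquad\text{and}\qquad \ell^\infty\subsetneq\mathfrak{X}.$$
   Context: $\mathbb{N}=\{1,2,\dots\}$, $\mathbb{N}_0=\mathbb{N}\cup\{0\}$. Let $\alpha_{\nu,j}\in\,]0,\infty[$ for $\nu\in\mathbb{N}_0$, $j\in\mathbb{N}$ (Fourier weights). $h_\nu$ are the Hermite polynomials normalized in $L^2(\mu_0)$, $\mu_0$ the standard normal distribution on $\mathbb{R}$: $h_\nu(x)=\sqrt{\nu!}\sum_{k=0}^{\lfloor \nu/2\rfloor}(-1)^k\frac{x^{\nu-2k}}{2^k\,k!\,(\nu-2k)!}$. Put $k_j^*(x,y):=\sum_{\nu\in\mathbb{N}}\alpha_{\nu,j}^{-1}h_\nu(x)h_\nu(y)$ for $x,y\in\mathbb{R}$ (convergent under (i)), and $$\mathfrak{X}:=\Bigl\{\boldsymbol{x}\in\mathbb{R}^{\mathbb{N}}:\sum_{j\in\mathbb{N}}k_j^*(x_j,x_j)<\infty\Bigr\}.$$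 For $\nu\in\mathbb{N}$, $\boldsymbol{\alpha}_\nu^{-1}:=(\alpha_{\nu,j}^{-1})_{j\in\mathbb{N}}$ and $\ell^{2\nu}(\boldsymbol{\alpha}_\nu^{-1})$ is the set of all $\boldsymbol{x}\in\mathbb{R}^{\mathbb{N}}$ with $\sum_{j\in\mathbb{N}}\alpha_{\nu,j}^{-1}x_j^{2\nu}<\infty$. $\ell^\infty$ is the space of bounded real sequences. $\mu$ is the countable product of $\mu_0$ on $\mathbb{R}^{\mathbb{N}}$ with the product $\sigma$-algebra. *)

theory Defs
  imports "HOL-Probability.Probability"
begin

text \<open>
  The paper's index set of positive integers is \<open>{1..} :: nat set\<close>. Real sequences indexed by it are
  represented as extensional functions on \<open>{1..}\<close>, the representation used by \<^const>\<open>PiM\<close>.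
\<close>

definition real_seqs :: "(nat \<Rightarrow> real) set" where
  "real_seqs = {1..} \<rightarrow>\<^sub>E UNIV"

text \<open>Hermite polynomials, normalized in \<open>L\<^sup>2\<close> of the standard normal distribution.\<close>

definition hermite :: "nat \<Rightarrow> real \<Rightarrow> real" where
  "hermite \<nu> x = sqrt (fact \<nu>) *
     (\<Sum>k\<le>\<nu> div 2. (-1) ^ k * (x ^ (\<nu> - 2 * k) / (2 ^ k * fact k * fact (\<nu> - 2 * k))))"

text \<open>
  In all definitions below, \<open>\<alpha> \<nu> j\<close> is the Fourier weight with first index \<open>\<nu> \<ge> 0\<close> and second index
  \<open>j \<ge> 1\<close>; the values \<open>\<alpha> \<nu> 0\<close> are never used.
\<close>

definition weights_summable :: "(nat \<Rightarrow> nat \<Rightarrow> real) \<Rightarrow> bool" where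
  "weights_summable \<alpha> \<longleftrightarrow>
     (\<forall>j\<ge>1. (\<lambda>\<nu>. inverse (\<alpha> \<nu> j) * real \<nu> powr (-1/2)) summable_on {1..})"

text \<open>
  The kernel is only meaningful where its series converges, which is the case for all \<open>j \<ge> 1\<close> and
  all real arguments if \<^const>\<open>weights_summable\<close> holds; \<^const>\<open>infsum\<close> is \<open>0\<close> elsewhere.
\<close>

definition kernel_star :: "(nat \<Rightarrow> nat \<Rightarrow> real) \<Rightarrow> nat \<Rightarrow> real \<Rightarrow> real \<Rightarrow> real" where
  "kernel_star \<alpha> j x y = (\<Sum>\<^sub>\<infinity>\<nu>\<in>{1..}. inverse (\<alpha> \<nu> j) * hermite \<nu> x * hermite \<nu> y)"

definition kernel_domain :: "(nat \<Rightarrow> nat \<Rightarrow> real) \<Rightarrow> (nat \<Rightarrow> real) set" where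
  "kernel_domain \<alpha> = {x \<in> real_seqs. (\<lambda>j. kernel_star \<alpha> j (x j) (x j)) summable_on {1..}}"

text \<open>The set \<open>\<ell>\<^sup>2\<^sup>\<nu>(w)\<close> for a sequence of weights \<open>w\<close>.\<close>

definition weighted_ell_even :: "nat \<Rightarrow> (nat \<Rightarrow> real) \<Rightarrow> (nat \<Rightarrow> real) set" where
  "weighted_ell_even \<nu> w = {x \<in> real_seqs. (\<lambda>j. w j * x j ^ (2 * \<nu>)) summable_on {1..}}"

definition ell_infinity :: "(nat \<Rightarrow> real) set" where
  "ell_infinity = {x \<in> real_seqs. bounded (x ` {1..})}"

definition gauss_product :: "(nat \<Rightarrow> real) measure" where
  "gauss_product = (\<Pi>\<^sub>M j\<in>{1..}. density lborel (\<lambda>x. ennreal (std_normal_density x)))"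

lemma space_gauss_product: "space gauss_product = real_seqs"
  by (simp add: gauss_product_def real_seqs_def space_PiM)

end

theory Submission
  imports Defs "HOL-Computational_Algebra.Polynomial"
begin

text \<open>
  Everything rests on two facts about the normalized Hermite polynomials \<open>h\<^sub>n\<close>: a pointwise bound
  and their norm in \<open>L\<^sup>2\<close> of the Gaussian.

  The pointwise bound is \<open>h\<^sub>n(x)\<^sup>2 \<le> C n\<^bsup>-1/2\<^esup>\<close> for \<open>n \<ge> 1\<close>, uniformly for \<open>x\<close> in a bounded set
  (\<open>hermite_sq_le_powr\<close>). It follows from the three-term recurrence by an energy argument. Let
  \<open>W\<^sub>n\<close> be the Wallis ratios, which decrease like \<open>n\<^bsup>-1/2\<^esup>\<close>. The rescaled values
  \<open>b\<^sub>n = h\<^sub>n(x) / \<surd>W\<^sub>n\<close> satisfy \<open>b\<^sub>n\<^sub>+\<^sub>2 + b\<^sub>n = c\<^sub>n\<^sub>+\<^sub>1 b\<^sub>n\<^sub>+\<^sub>1\<close> with \<open>c\<^sub>n = x W\<^sub>n / \<surd>2\<close>, and along this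
  recurrence the energy \<open>b\<^sub>n\<^sup>2 + b\<^sub>n\<^sub>+\<^sub>1\<^sup>2 - c\<^sub>n b\<^sub>n b\<^sub>n\<^sub>+\<^sub>1\<close> changes only by \<open>(c\<^sub>n - c\<^sub>n\<^sub>+\<^sub>1) b\<^sub>n b\<^sub>n\<^sub>+\<^sub>1\<close>. Since
  \<open>c\<^sub>n\<close> tends monotonically to \<open>0\<close>, its total variation is finite, the energy stays bounded, and so
  does \<open>b\<^sub>n\<close>.

  The norm \<open>E h\<^sub>n(Z)\<^sup>2 = 1\<close> for a standard Gaussian \<open>Z\<close> (\<open>nn_integral_hermite_sq\<close>) comes from
  integration by parts, \<open>E Z p(Z) = E p'(Z)\<close> for polynomials \<open>p\<close>, which is the recursion of the
  Gaussian moments.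

  For (a), the pointwise bound makes every kernel series converge, so that the kernel at \<open>(x\<^sub>j, x\<^sub>j)\<close>
  dominates each of its partial sums. Because the weights increase in the first index, these partial
  sums dominate \<open>\<alpha>\<^bsub>\<nu>,j\<^esub>\<^sup>-\<^sup>1\<close> times the sum of \<open>h\<^sub>\<mu>(x\<^sub>j)\<^sup>2\<close> over \<open>1 \<le> \<mu> \<le> \<nu>\<close>, and the latter controls
  \<open>x\<^sub>j\<^bsup>2\<nu>\<^esup>\<close> (\<open>power_le_sum_hermite_sq\<close>). Strictness is witnessed by \<open>x\<^sub>j = \<surd>\<alpha>\<^bsub>1,j\<^esub>\<close>, whose
  weighted squares are all \<open>1\<close>.

  For (b), put \<open>s\<^sub>j = \<Sum>\<^sub>\<nu> \<alpha>\<^bsub>\<nu>,j\<^esub>\<^sup>-\<^sup>1\<close>, which is summable over \<open>j \<ge> j\<^sub>0\<close>. On a bounded set the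
  kernel with such an index \<open>j\<close> is at most a constant times \<open>s\<^sub>j\<close>, so bounded sequences lie in
  the domain. The kernel at a fixed point also tends to \<open>0\<close> as \<open>j\<close> grows, so an unbounded sequence in the domain arises by placing the value \<open>n\<close> at
  a position so far out that it contributes at most \<open>2\<^bsup>-n\<^esup>\<close>, and \<open>0\<close> elsewhere. Finally the
  expectation of the kernel is \<open>s\<^sub>j\<close>, so the sum of the kernels has finite expectation over
  \<open>j \<ge> j\<^sub>0\<close> and is therefore almost surely finite.
\<close>

section \<open>Sums over final segments of the natural numbers\<close>

lemma summable_on_atLeast_iff:
  fixes f :: "nat \<Rightarrow> real"
  assumes "\<And>n. n \<ge> m \<Longrightarrow> 0 \<le> f n"
  shows "f summable_on {m..} \<longleftrightarrow> summable (\<lambda>n. f (n + m))"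
proof -
  have "bij_betw (\<lambda>n. n + m) UNIV {m..}"
    by (rule bij_betwI[where g = "\<lambda>n. n - m"]) auto
  then have "f summable_on {m..} \<longleftrightarrow> (\<lambda>n. f (n + m)) summable_on UNIV"
    using summable_on_reindex_bij_betw by blast
  also have "\<dots> \<longleftrightarrow> summable (\<lambda>n. f (n + m))"
    using assms by (intro summable_on_UNIV_nonneg_real_iff) auto
  finally show ?thesis .
qed

lemma infsum_atLeast_sums:
  fixes f :: "nat \<Rightarrow> real"
  assumes "f summable_on {m..}"
  shows "(\<lambda>n. f (n + m)) sums infsum f {m..}"
proof -
  have "bij_betw (\<lambda>n. n + m) UNIV {m..}"
    by (rule bij_betwI[where g = "\<lambda>n. n - m"]) auto
  then have "((\<lambda>n. f (n + m)) has_sum infsum f {m..}) UNIV"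
    using assms has_sum_reindex_bij_betw[of "\<lambda>n. n + m" UNIV "{m..}" f] by simp
  then show ?thesis by (rule has_sum_imp_sums)
qed

lemma summable_on_atLeast_change_start:
  fixes f :: "nat \<Rightarrow> real"
  assumes "f summable_on {m..}"
  shows "f summable_on {k..}"
proof -
  have "f summable_on ({m..} \<union> {..<m})"
    using assms by (intro summable_on_Un_disjoint) auto
  moreover have "{m..} \<union> {..<m} = UNIV" by auto
  ultimately show ?thesis
    by (metis subset_UNIV summable_on_subset_banach)
qed

section \<open>Recurrence and derivatives of Hermite polynomials\<close>

lemma hermite_0 [simp]: "hermite 0 x = 1"
  by (simp add: hermite_def)

lemma hermite_1 [simp]: "hermite (Suc 0) x = x"
  by (simp add: hermite_def)

text \<open>
  The summands of \<open>h\<^sub>n / \<surd>(n!)\<close>, continued by \<open>0\<close> beyond \<open>n div 2\<close> so that sums for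
  neighbouring \<open>n\<close> can be taken over a common range.
\<close>

definition appell_term :: "nat \<Rightarrow> real \<Rightarrow> nat \<Rightarrow> real" where
  "appell_term n x k =
     (if 2 * k \<le> n then (-1) ^ k * (x ^ (n - 2 * k) / (2 ^ k * fact k * fact (n - 2 * k))) else 0)"

lemma hermite_eq_sum_appell_term:
  assumes "n div 2 \<le> N"
  shows "hermite n x = sqrt (fact n) * (\<Sum>k\<le>N. appell_term n x k)"
proof -
  have "(\<Sum>k\<le>N. appell_term n x k) = (\<Sum>k\<le>n div 2. appell_term n x k)"
    using assms by (intro sum.mono_neutral_right) (auto simp: appell_term_def)
  also have "\<dots> = (\<Sum>k\<le>n div 2. (-1) ^ k * (x ^ (n - 2 * k) / (2 ^ k * fact k * fact (n - 2 * k))))"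
    by (intro sum.cong) (auto simp: appell_term_def)
  finally show ?thesis
    by (simp add: hermite_def)
qed

lemma appell_term_x:
  "real (n + 2 - 2 * k) * appell_term (n + 2) x k = x * appell_term (n + 1) x k"
proof (cases "2 * k \<le> n + 1")
  case True
  define m where "m = n + 1 - 2 * k"
  have "n + 2 - 2 * k = Suc m" "n + 1 - 2 * k = m" using True by (auto simp: m_def)
  with True show ?thesis
    by (simp add: appell_term_def field_simps del: of_nat_Suc)
next
  case False
  then show ?thesis by (simp add: appell_term_def)
qed

lemma appell_term_shift:
  "2 * real (Suc k) * appell_term (n + 2) x (Suc k) = - appell_term n x k"
  by (simp add: appell_term_def field_simps del: of_nat_Suc)

text \<open>
  Split the factor \<open>n + 2\<close> as \<open>(n + 2 - 2k) + 2k\<close>: the first part lowers the power of \<open>x\<close> by one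
  and yields the summands for \<open>n + 1\<close>, the second lowers \<open>k\<close> by one and yields those for \<open>n\<close>.
\<close>

lemma sum_appell_term_recurrence:
  "real (n + 2) * (\<Sum>k\<le>Suc n. appell_term (n + 2) x k) =
     x * (\<Sum>k\<le>Suc n. appell_term (n + 1) x k) - (\<Sum>k\<le>n. appell_term n x k)"
proof -
  have "real (n + 2) * appell_term (n + 2) x k =
          x * appell_term (n + 1) x k + 2 * real k * appell_term (n + 2) x k" for k
  proof (cases "2 * k \<le> n + 2")
    case True
    then have "real (n + 2) = real (n + 2 - 2 * k) + 2 * real k" by (simp add: of_nat_diff)
    then show ?thesis
      by (simp only: distrib_right appell_term_x)
  next
    case False
    then show ?thesis by (simp add: appell_term_def)
  qed
  then have "real (n + 2) * (\<Sum>k\<le>Suc n. appell_term (n + 2) x k) =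
     x * (\<Sum>k\<le>Suc n. appell_term (n + 1) x k) + (\<Sum>k\<le>Suc n. 2 * real k * appell_term (n + 2) x k)"
    by (simp only: sum_distrib_left sum.distrib)
  also have "(\<Sum>k\<le>Suc n. 2 * real k * appell_term (n + 2) x k) = - (\<Sum>k\<le>n. appell_term n x k)"
    by (simp only: sum.atMost_Suc_shift appell_term_shift) (simp add: sum_negf)
  finally show ?thesis by simp
qed

lemma hermite_recurrence:
  "sqrt (real n + 2) * hermite (n + 2) x = x * hermite (n + 1) x - sqrt (real n + 1) * hermite n x"
proof -
  have sqrt_fact: "sqrt (fact (n + 2)) = sqrt (real n + 2) * sqrt (real n + 1) * sqrt (fact n)"
    "sqrt (fact (n + 1)) = sqrt (real n + 1) * sqrt (fact n)"
    by (simp_all add: algebra_simps flip: real_sqrt_mult)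
  define S where "S m N = (\<Sum>k\<le>N. appell_term m x k)" for m N
  have h: "hermite (n + 2) x = sqrt (real n + 2) * sqrt (real n + 1) * sqrt (fact n) * S (n + 2) (Suc n)"
    "hermite (n + 1) x = sqrt (real n + 1) * sqrt (fact n) * S (n + 1) (Suc n)"
    "hermite n x = sqrt (fact n) * S n n"
    using hermite_eq_sum_appell_term[of "n + 2" "Suc n" x]
      hermite_eq_sum_appell_term[of "n + 1" "Suc n" x] hermite_eq_sum_appell_term[of n n x]
    by (simp_all only: S_def sqrt_fact)
  have "sqrt (real n + 2) * hermite (n + 2) x
      = sqrt (real n + 1) * sqrt (fact n) * (real (n + 2) * S (n + 2) (Suc n))"
    unfolding h by simp
  also have "\<dots> = x * hermite (n + 1) x - sqrt (real n + 1) * hermite n x"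
    unfolding h by (simp only: S_def sum_appell_term_recurrence) (simp add: algebra_simps)
  finally show ?thesis .
qed

text \<open>
  This form of the recursion is the one suited to integration by parts: multiplication by \<open>x\<close> minus
  differentiation is the adjoint of differentiation in \<open>L\<^sup>2\<close> of the Gaussian.
\<close>

fun monic_hermite :: "nat \<Rightarrow> real poly" where
  "monic_hermite 0 = 1"
| "monic_hermite (Suc n) = pCons 0 (monic_hermite n) - pderiv (monic_hermite n)"

lemma pderiv_monic_hermite:
  "pderiv (monic_hermite (Suc n)) = smult (real (Suc n)) (monic_hermite n)"
proof (induction n)
  case 0
  show ?case by (simp add: pderiv_pCons one_pCons)
next
  case (Suc n)
  have "pderiv (monic_hermite (Suc (Suc n))) = monic_hermite (Suc n) + 
     (pCons 0 (pderiv (monic_hermite (Suc n))) - pderiv (pderiv (monic_hermite (Suc n))))"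
    by (subst monic_hermite.simps) (simp add: pderiv_pCons pderiv_diff)
  also have "\<dots> = smult (real (Suc (Suc n))) (monic_hermite (Suc n))"
  proof -
    have "pCons 0 (smult c p) - pderiv (smult c p) = smult c (pCons 0 p - pderiv p)"
      for c and p :: "real poly"
      by (simp add: pderiv_smult smult_diff_right)
    note scale = this
    show ?thesis
      unfolding Suc.IH scale monic_hermite.simps(2)[of n, symmetric]
      using smult_add_left[of 1 "real (Suc n)" "monic_hermite (Suc n)"]
      by (simp add: algebra_simps del: monic_hermite.simps)
  qed
  finally show ?case .
qed

text \<open>
  Both sides satisfy the same three-term recurrence; on the right it results from the recursion by
  inserting the formula for the derivative.
\<close>

lemma hermite_eq_poly: "hermite n x = poly (monic_hermite n) x / sqrt (fact n)"
proof -
  have "hermite n x = poly (monic_hermite n) x / sqrt (fact n) \<and>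
        hermite (n + 1) x = poly (monic_hermite (n + 1)) x / sqrt (fact (n + 1))"
  proof (induction n)
    case 0
    show ?case by simp
  next
    case (Suc n)
    have p: "poly (monic_hermite (n + 2)) x
          = x * poly (monic_hermite (n + 1)) x - real (n + 1) * poly (monic_hermite n) x"
      using pderiv_monic_hermite[of n] by simp
    have f: "sqrt (fact (n + 2)) = sqrt (real n + 2) * sqrt (real n + 1) * sqrt (fact n)"
      "sqrt (fact (n + 1)) = sqrt (real n + 1) * sqrt (fact n)"
      by (simp_all add: algebra_simps flip: real_sqrt_mult)
    have h: "hermite (n + 1) x = poly (monic_hermite (n + 1)) x / (sqrt (real n + 1) * sqrt (fact n))"
       "hermite n x = poly (monic_hermite n) x / sqrt (fact n)"
      using Suc unfolding f by auto
    have "sqrt (real n + 2) * hermite (n + 2) x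
        = sqrt (real n + 2) * (poly (monic_hermite (n + 2)) x / sqrt (fact (n + 2)))"
      unfolding hermite_recurrence f h p 
      by (simp add: field_simps flip: power2_eq_square)
    moreover have "sqrt (real n + 2) \<noteq> 0" by simp
    ultimately have "hermite (n + 2) x = poly (monic_hermite (n + 2)) x / sqrt (fact (n + 2))"
      using mult_left_cancel by blast
    with Suc show ?case by (simp del: monic_hermite.simps fact_Suc)
  qed
  then show ?thesis ..
qed

section \<open>The Gaussian norm of Hermite polynomials\<close>

definition gauss_mean :: "real poly \<Rightarrow> real" where
  "gauss_mean p = (\<integral>x. std_normal_density x * poly p x \<partial>lborel)"

lemma integrable_gauss_poly:
  "integrable lborel (\<lambda>x. std_normal_density x * poly p x)"
proof -
  have "integrable lborel (\<lambda>x. \<Sum>i\<le>degree p. coeff p i * (std_normal_density x * x ^ i))"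
    by (intro Bochner_Integration.integrable_sum integrable_mult_right integrable_std_normal_moment)
  then show ?thesis
    by (simp add: poly_altdef sum_distrib_left mult.left_commute)
qed

lemma gauss_mean_add: "gauss_mean (p + q) = gauss_mean p + gauss_mean q"
  using integrable_gauss_poly[of p] integrable_gauss_poly[of q]
  by (simp add: gauss_mean_def distrib_left)

lemma gauss_mean_smult: "gauss_mean (smult c p) = c * gauss_mean p"
  by (simp add: gauss_mean_def mult.left_commute)

lemma gauss_mean_0 [simp]: "gauss_mean 0 = 0"
  by (simp add: gauss_mean_def)

lemma gauss_mean_diff: "gauss_mean (p - q) = gauss_mean p - gauss_mean q"
proof -
  have "p - q = p + smult (-1) q" by simp
  then show ?thesis
    by (simp only: gauss_mean_add gauss_mean_smult)
qed

lemma gauss_mean_sum: "gauss_mean (\<Sum>i\<in>I. f i) = (\<Sum>i\<in>I. gauss_mean (f i))"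
  by (induction I rule: infinite_finite_induct) (simp_all add: gauss_mean_add)

text \<open>
  The case of a monomial in Gaussian integration by parts, read off from the known moments.
\<close>

lemma gauss_moment_rec:
  "gauss_mean (monom 1 (k + 2)) = real (k + 1) * gauss_mean (monom 1 k)"
proof (cases "even k")
  case True
  then obtain l where k: "k = 2 * l" by blast
  have *: "k + 2 = 2 * (l + 1)" using k by simp
  show ?thesis
    unfolding gauss_mean_def poly_monom *
    unfolding k mult_1 integral_std_normal_moment_even
    by (simp add: divide_simps)
next
  case False
  then obtain l where k: "k = 2 * l + 1" by (rule oddE)
  have *: "k + 2 = 2 * (l + 1) + 1" using k by simp
  show ?thesis
    unfolding gauss_mean_def poly_monom *
    unfolding k by (simp only: mult_1 integral_std_normal_moment_odd)
qed

text \<open>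
  Both sides are linear in \<open>p\<close>, so monomials suffice, where this is the recursion of the moments.
\<close>

lemma gauss_mean_by_parts: "gauss_mean (pCons 0 p) = gauss_mean (pderiv p)"
proof -
  have m: "gauss_mean (pCons 0 (monom c i)) = gauss_mean (pderiv (monom c i))" for c i
  proof (cases i)
    case 0
    have "gauss_mean (monom 1 1) = 0"
      using integral_std_normal_moment_odd[of 0] by (simp add: gauss_mean_def poly_monom)
    then have "gauss_mean (monom c 1) = 0"
      using gauss_mean_smult[of c "monom 1 1"] by (simp add: smult_monom)
    with 0 show ?thesis
      by (simp add: monom_Suc monom_0 pderiv_pCons)
  next
    case (Suc k)
    have "gauss_mean (pCons 0 (monom c i)) = c * gauss_mean (monom 1 (k + 2))"
      using gauss_mean_smult[of c "monom 1 (k + 2)"]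
      by (simp add: smult_monom Suc monom_Suc)
    also have "\<dots> = (real (k + 1) * c) * gauss_mean (monom 1 k)"
      by (simp add: gauss_moment_rec del: add_2_eq_Suc')
    also have "\<dots> = gauss_mean (pderiv (monom c i))"
      using gauss_mean_smult[of "real (k + 1) * c" "monom 1 k"]
      by (simp add: Suc pderiv_monom smult_monom)
    finally show ?thesis .
  qed
  have "pCons 0 (\<Sum>i\<le>degree p. monom (coeff p i) i) = (\<Sum>i\<le>degree p. pCons 0 (monom (coeff p i) i))"
    using sum_distrib_left[of "[:0, 1:]" "\<lambda>i. monom (coeff p i) i" "{..degree p}"] by simp
  moreover have "pderiv (\<Sum>i\<in>I. monom (coeff p i) i) = (\<Sum>i\<in>I. pderiv (monom (coeff p i) i))" for I
    by (induction I rule: infinite_finite_induct) (simp_all add: pderiv_add)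
  ultimately show ?thesis
    using m by (subst (1 2) poly_as_sum_of_monoms[of p, symmetric])
      (simp only: gauss_mean_sum)
qed

text \<open>
  Integration by parts moves the operator that raises \<open>He\<^sub>n\<close> to \<open>He\<^sub>n\<^sub>+\<^sub>1\<close> onto the second factor as a
  derivative, and \<open>He\<^sub>n\<^sub>+\<^sub>1' = (n + 1) He\<^sub>n\<close>; so every step contributes the factor \<open>n + 1\<close>.
\<close>

lemma gauss_mean_monic_hermite_sq:
  "gauss_mean (monic_hermite n * monic_hermite n) = fact n"
proof (induction n)
  case 0
  show ?case using integral_std_normal_moment_even[of 0] by (simp add: gauss_mean_def)
next
  case (Suc n)
  let ?H = "monic_hermite"
  have "gauss_mean (?H (Suc n) * ?H (Suc n)) 
      = gauss_mean (pCons 0 (?H n * ?H (Suc n)) - pderiv (?H n) * ?H (Suc n))"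
    by (simp add: left_diff_distrib)
  also have "\<dots> = gauss_mean (?H n * pderiv (?H (Suc n)))"
    by (simp only: gauss_mean_diff gauss_mean_by_parts pderiv_mult gauss_mean_add)
      (simp add: mult.commute)
  also have "\<dots> = fact (Suc n)"
    unfolding pderiv_monic_hermite by (simp add: gauss_mean_smult Suc.IH del: monic_hermite.simps)
  finally show ?case .
qed

abbreviation std_gauss :: "real measure" where
  "std_gauss \<equiv> density lborel (\<lambda>x. ennreal (std_normal_density x))"

lemma borel_measurable_hermite [measurable]: "hermite n \<in> borel_measurable borel"
  unfolding hermite_def by measurable

lemma nn_integral_hermite_sq:
  "(\<integral>\<^sup>+x. ennreal ((hermite n x)\<^sup>2) \<partial>std_gauss) = 1"
proof -
  let ?p = "monic_hermite n * monic_hermite n"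
  have [measurable]: "poly p \<in> borel_measurable borel" for p :: "real poly"
    by (intro borel_measurable_continuous_onI continuous_intros)
  have "(\<integral>\<^sup>+x. ennreal ((hermite n x)\<^sup>2) \<partial>std_gauss)
      = (\<integral>\<^sup>+x. ennreal (std_normal_density x * poly ?p x / fact n) \<partial>lborel)"
    by (subst nn_integral_density)
       (auto simp: hermite_eq_poly power2_eq_square ennreal_mult' intro!: nn_integral_cong
          simp flip: ennreal_mult)
  also have "\<dots> = ennreal (gauss_mean ?p / fact n)"
    unfolding gauss_mean_def using integrable_gauss_poly[of ?p]
    by (subst nn_integral_eq_integral) auto
  finally show ?thesis
    by (simp add: gauss_mean_monic_hermite_sq)
qed

section \<open>A locally uniform bound for Hermite polynomials\<close>

text \<open>
  Up to the constant \<open>\<surd>\<pi> / 2\<close> this is the Wallis integral of \<open>sin\<^sup>n\<close> over \<open>[0, \<pi>/2]\<close>. It serves as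
  the squared scale of \<open>h\<^sub>n\<close>, because the product of neighbours is explicit and because it is monotone.
\<close>

definition wallis :: "nat \<Rightarrow> real" where
  "wallis n = Gamma ((real n + 1) / 2) / Gamma (real n / 2 + 1)"

lemma wallis_pos [simp]: "0 < wallis n"
  unfolding wallis_def by (intro divide_pos_pos Gamma_real_pos) (simp_all add: add_nonneg_pos)

lemma wallis_mult_Suc: "(real n + 1) * (wallis n * wallis (Suc n)) = 2"
proof -
  define y where "y = (real n + 1) / 2"
  have y: "y > 0" by (simp add: y_def)
  have "wallis n = Gamma y / Gamma (y + 1 / 2)" "wallis (Suc n) = Gamma (y + 1 / 2) / Gamma (y + 1)"
    by (simp_all add: wallis_def y_def field_simps)
  moreover have "Gamma (y + 1) = y * Gamma y"
    using y by (intro Gamma_plus1) (auto elim!: nonpos_Ints_cases')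
  moreover have "Gamma y > 0" "Gamma (y + 1 / 2) > 0"
    using y by (auto intro!: Gamma_real_pos)
  moreover from this have "Gamma y \<noteq> 0" "Gamma (y + 1 / 2) \<noteq> 0" by (auto simp only:)
  ultimately have "wallis n * wallis (Suc n) = 1 / y"
    using y by simp
  then show ?thesis
    using y by (simp add: y_def field_simps)
qed

text \<open>
  This is log-convexity of the Gamma function at the midpoint of \<open>(n + 1) / 2\<close> and \<open>(n + 3) / 2\<close>.
\<close>

lemma wallis_Suc_le: "wallis (Suc n) \<le> wallis n"
proof -
  define y where "y = (real n + 1) / 2"
  have y: "y > 0" by (simp add: y_def)
  have eq: "(1 - 1 / 2) *\<^sub>R y + (1 / 2) *\<^sub>R (y + 1) = y + 1 / 2"
    by (simp add: field_simps)
  have pos: "Gamma y > 0" "Gamma (y + 1 / 2) > 0" "Gamma (y + 1) > 0"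
    using y by (auto intro!: Gamma_real_pos)
  have "(ln \<circ> Gamma) ((1 - 1 / 2) *\<^sub>R y + (1 / 2) *\<^sub>R (y + 1))
      \<le> (1 - 1 / 2) * (ln \<circ> Gamma) y + (1 / 2) * (ln \<circ> Gamma) (y + 1)"
    using y by (intro convex_onD[OF log_convex_Gamma_real]) auto
  then have "2 * ln (Gamma (y + 1 / 2)) \<le> ln (Gamma y) + ln (Gamma (y + 1))"
    unfolding eq by simp
  then have "ln ((Gamma (y + 1 / 2))\<^sup>2) \<le> ln (Gamma y * Gamma (y + 1))"
    using pos by (simp add: ln_mult ln_realpow)
  then have "(Gamma (y + 1 / 2))\<^sup>2 \<le> Gamma y * Gamma (y + 1)"
    using pos by (subst (asm) ln_le_cancel_iff) auto
  moreover have "wallis n = Gamma y / Gamma (y + 1 / 2)" "wallis (Suc n) = Gamma (y + 1 / 2) / Gamma (y + 1)"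
    by (simp_all add: wallis_def y_def field_simps)
  ultimately show ?thesis
    using pos by (simp add: frac_le_eq divide_le_0_iff power2_eq_square mult.commute)
qed

text \<open>
  By monotonicity the square is at most the explicit product of two neighbours.
\<close>

lemma wallis_le:
  assumes "n \<ge> 1"
  shows "wallis n \<le> 2 / sqrt (real n)"
proof -
  obtain m where n: "n = Suc m" using assms by (cases n) auto
  have "(wallis n)\<^sup>2 \<le> wallis m * wallis n"
    unfolding n power2_eq_square by (intro mult_right_mono wallis_Suc_le) (simp add: less_imp_le)
  also have "\<dots> = 2 / real n"
    using wallis_mult_Suc[of m] by (simp add: n field_simps)
  also have "\<dots> \<le> (2 / sqrt (real n))\<^sup>2"
    by (simp add: power_divide divide_right_mono)
  finally show ?thesis
    by (rule power2_le_imp_le) simp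
qed

text \<open>
  For constant \<open>c\<close> the recurrence preserves the quadratic form \<open>Q\<close> below; in general \<open>Q\<close> grows in
  each step by a factor of at most \<open>exp (\<bar>c\<^sub>n\<bar> - \<bar>c\<^sub>n\<^sub>+\<^sub>1\<bar>)\<close>, and the product of these factors telescopes.
  The assumption \<open>var\<close> says that \<open>c\<close> keeps its sign and decreases in absolute value; while
  \<open>\<bar>c\<^sub>n\<bar> \<le> 1\<close>, the form \<open>Q\<close> is comparable to \<open>b\<^sub>n\<^sup>2 + b\<^sub>n\<^sub>+\<^sub>1\<^sup>2\<close>. The constant \<open>9\<close> is \<open>3\<close>, an upper bound
  for \<open>exp 1\<close>, times the ratio \<open>3\<close> of the two comparison constants.
\<close>

lemma three_term_energy_bound:
  fixes b c :: "nat \<Rightarrow> real"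
  assumes rec: "\<And>n. b (n + 2) = c (n + 1) * b (n + 1) - b n"
    and small: "\<And>n. n \<ge> N \<Longrightarrow> \<bar>c n\<bar> \<le> 1"
    and var: "\<And>n. \<bar>c n - c (Suc n)\<bar> \<le> \<bar>c n\<bar> - \<bar>c (Suc n)\<bar>"
    and "n \<ge> N"
  shows "(b n)\<^sup>2 \<le> 9 * ((b N)\<^sup>2 + (b (Suc N))\<^sup>2)"
proof -
  define Q where "Q n = (b n)\<^sup>2 + (b (Suc n))\<^sup>2 - c n * b n * b (Suc n)" for n
  have am_gm: "2 * \<bar>b n * b (Suc n)\<bar> \<le> (b n)\<^sup>2 + (b (Suc n))\<^sup>2" for n
    using sum_squares_bound[of "\<bar>b n\<bar>" "\<bar>b (Suc n)\<bar>"] by (simp add: abs_mult)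
  have cross: "\<bar>c n * b n * b (Suc n)\<bar> \<le> \<bar>b n * b (Suc n)\<bar>" if "n \<ge> N" for n
    using mult_right_mono[OF small[OF that], of "\<bar>b n * b (Suc n)\<bar>"]
    by (simp add: abs_mult mult.assoc)
  have lower: "(b n)\<^sup>2 + (b (Suc n))\<^sup>2 \<le> 2 * Q n" 
    and upper: "2 * Q n \<le> 3 * ((b n)\<^sup>2 + (b (Suc n))\<^sup>2)" if "n \<ge> N" for n
    using cross[OF that] am_gm[of n] by (auto simp: Q_def)
  have energy_step: "Q (Suc n) \<le> exp (\<bar>c n\<bar> - \<bar>c (Suc n)\<bar>) * Q n" if "n \<ge> N" for n
  proof -
    have "Q (Suc n) = Q n + (c n - c (Suc n)) * (b n * b (Suc n))"
    proof -
      have next_b: "b (Suc (Suc n)) = c (Suc n) * b (Suc n) - b n" using rec[of n] by simp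
      show ?thesis unfolding Q_def power2_eq_square next_b by (simp add: algebra_simps)
    qed
    also have "(c n - c (Suc n)) * (b n * b (Suc n)) \<le> \<bar>c n - c (Suc n)\<bar> * \<bar>b n * b (Suc n)\<bar>"
      by (simp flip: abs_mult)
    also have "\<dots> \<le> (\<bar>c n\<bar> - \<bar>c (Suc n)\<bar>) * Q n"
      using var[of n] lower[OF that] am_gm[of n] by (intro mult_mono) auto
    also have "Q n + (\<bar>c n\<bar> - \<bar>c (Suc n)\<bar>) * Q n = (1 + (\<bar>c n\<bar> - \<bar>c (Suc n)\<bar>)) * Q n"
      by (simp add: algebra_simps)
    also have "\<dots> \<le> exp (\<bar>c n\<bar> - \<bar>c (Suc n)\<bar>) * Q n"
      using lower[OF that] am_gm[of n] by (intro mult_right_mono exp_ge_add_one_self) auto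
    finally show ?thesis by simp
  qed
  have "Q n \<le> exp (\<bar>c N\<bar> - \<bar>c n\<bar>) * Q N"
    using \<open>n \<ge> N\<close>
  proof (induction n rule: dec_induct)
    case (step n)
    note energy_step[OF \<open>N \<le> n\<close>]
    also have "exp (\<bar>c n\<bar> - \<bar>c (Suc n)\<bar>) * Q n
        \<le> exp (\<bar>c n\<bar> - \<bar>c (Suc n)\<bar>) * (exp (\<bar>c N\<bar> - \<bar>c n\<bar>) * Q N)"
      using step.IH by (rule mult_left_mono) simp
    also have "\<dots> = exp (\<bar>c N\<bar> - \<bar>c (Suc n)\<bar>) * Q N"
      by (simp add: mult.assoc[symmetric] exp_add[symmetric])
    finally show ?case .
  qed simp
  also have "\<dots> \<le> 3 * Q N"
  proof (rule mult_right_mono)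
    have "\<bar>c N\<bar> - \<bar>c n\<bar> \<le> 1" using small[of N] by simp
    then have "exp (\<bar>c N\<bar> - \<bar>c n\<bar>) \<le> exp 1" by simp
    then show "exp (\<bar>c N\<bar> - \<bar>c n\<bar>) \<le> 3" using exp_le by linarith
    show "0 \<le> Q N" using lower[of N] am_gm[of N] by auto
  qed
  finally show ?thesis
    using lower[OF \<open>n \<ge> N\<close>] upper[of N] zero_le_power2[of "b (Suc n)"] by linarith
qed

text \<open>
  Dividing \<open>h\<^sub>n\<close> by the square root of the Wallis ratio turns the recurrence into one whose outer
  coefficients are both \<open>1\<close>, since \<open>\<surd>(n + 1) \<surd>W\<^sub>n \<surd>W\<^sub>n\<^sub>+\<^sub>1\<close> is the constant \<open>\<surd>2\<close>. The middle
  coefficient becomes \<open>x W\<^sub>n / \<surd>2\<close>, which is monotone in \<open>n\<close>.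
\<close>

lemma hermite_tail_bound:
  assumes N: "\<bar>x\<bar> * wallis N \<le> sqrt 2" and "n \<ge> N"
  shows "(hermite n x)\<^sup>2 \<le>
           9 * wallis n * ((hermite N x)\<^sup>2 / wallis N + (hermite (Suc N) x)\<^sup>2 / wallis (Suc N))"
proof -
  define b where "b n = hermite n x / sqrt (wallis n)" for n
  define c where "c n = x * wallis n / sqrt 2" for n
  have b_sq: "(b n)\<^sup>2 = (hermite n x)\<^sup>2 / wallis n" for n
    by (simp add: b_def power_divide less_imp_le)
  have rec: "b (n + 2) = c (n + 1) * b (n + 1) - b n" for n
  proof -
    define s where "s k = sqrt (wallis k)" for k
    have s: "s k > 0" "s k * s k = wallis k" "hermite k x = s k * b k" for k
      by (auto simp: s_def b_def less_imp_le less_imp_neq[THEN not_sym])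
    have prod: "sqrt (real k + 1) * (s k * s (Suc k)) = sqrt 2" for k
      unfolding s_def real_sqrt_mult[symmetric] wallis_mult_Suc ..
    have "s (n + 1) * (sqrt (real n + 2) * hermite (n + 2) x)
        = s (n + 1) * (x * hermite (n + 1) x - sqrt (real n + 1) * hermite n x)"
      by (simp only: hermite_recurrence)
    then have "(sqrt (real (n + 1) + 1) * (s (n + 1) * s (Suc (n + 1)))) * b (n + 2)
        = x * wallis (n + 1) * b (n + 1) - (sqrt (real n + 1) * (s n * s (Suc n))) * b n"
      unfolding s(3) s(2)[symmetric] by (simp add: algebra_simps)
    then show ?thesis
      unfolding prod by (simp add: c_def field_simps)
  qed
  have small: "\<bar>c m\<bar> \<le> 1" if "m \<ge> N" for m
  proof -
    have "wallis m \<le> wallis N"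
      using lift_Suc_antimono_le[of wallis, OF wallis_Suc_le that] .
    then have "\<bar>x\<bar> * wallis m \<le> \<bar>x\<bar> * wallis N" by (simp add: mult_left_mono)
    with N have "\<bar>x\<bar> * wallis m \<le> sqrt 2" by simp
    then show ?thesis by (simp add: c_def abs_mult less_imp_le)
  qed
  have var: "\<bar>c m - c (Suc m)\<bar> \<le> \<bar>c m\<bar> - \<bar>c (Suc m)\<bar>" for m
  proof -
    have "c m - c (Suc m) = x * (wallis m - wallis (Suc m)) / sqrt 2"
      by (simp add: c_def algebra_simps diff_divide_distrib)
    then have "\<bar>c m - c (Suc m)\<bar> = \<bar>x\<bar> * (wallis m - wallis (Suc m)) / sqrt 2"
      using wallis_Suc_le[of m] by (simp add: abs_mult)
    also have "\<dots> = \<bar>c m\<bar> - \<bar>c (Suc m)\<bar>"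
      by (simp add: c_def abs_mult algebra_simps diff_divide_distrib abs_of_pos)
    finally show ?thesis by simp
  qed
  show ?thesis
    using three_term_energy_bound[OF rec small var \<open>n \<ge> N\<close>]
    by (simp add: b_sq field_simps)
qed

lemma continuous_on_hermite: "continuous_on S (hermite n)"
  unfolding hermite_def by (intro continuous_intros) auto

lemma hermite_sq_bounded: "\<exists>M\<ge>0. \<forall>x. \<bar>x\<bar> \<le> B \<longrightarrow> (hermite n x)\<^sup>2 \<le> M"
proof -
  have "compact ((\<lambda>x. (hermite n x)\<^sup>2) ` cball 0 B)"
    by (intro compact_continuous_image continuous_intros continuous_on_hermite) auto
  then have "bounded ((\<lambda>x. (hermite n x)\<^sup>2) ` cball 0 B)"
    by (rule compact_imp_bounded)
  then obtain M where "\<forall>x\<in>cball 0 B. (hermite n x)\<^sup>2 \<le> M"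
    unfolding bounded_iff by auto
  then have "\<bar>x\<bar> \<le> B \<longrightarrow> (hermite n x)\<^sup>2 \<le> max M 0" for x
    by (auto simp: le_max_iff_disj)
  then show ?thesis
    by (intro exI[of _ "max M 0"]) simp
qed

text \<open>
  An index \<open>N \<ge> 2 B\<^sup>2\<close> makes the middle coefficients at most \<open>1\<close> from \<open>N\<close> on for all
  \<open>\<bar>x\<bar> \<le> B\<close>. The tail bound then reduces the claim to the decay of the Wallis ratios and to the maxima
  of finitely many polynomials on a compact interval.
\<close>

theorem hermite_sq_le_powr:
  "\<exists>C\<ge>0. \<forall>n\<ge>1. \<forall>x. \<bar>x\<bar> \<le> B \<longrightarrow> (hermite n x)\<^sup>2 \<le> C * real n powr (-1/2)"
proof -
  obtain M where M: "M n \<ge> 0" "\<bar>x\<bar> \<le> B \<Longrightarrow> (hermite n x)\<^sup>2 \<le> M n" for n x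
    using hermite_sq_bounded[of B] by metis
  define N where "N = nat \<lceil>2 * B\<^sup>2\<rceil> + 1"
  have N: "2 * B\<^sup>2 \<le> real N" "N \<ge> 1" unfolding N_def by linarith+
  have small: "\<bar>x\<bar> * wallis N \<le> sqrt 2" if "\<bar>x\<bar> \<le> B" for x
  proof -
    have "\<bar>x\<bar> * wallis N \<le> B * (2 / sqrt (real N))"
      using that wallis_le[OF N(2)] by (intro mult_mono) (auto simp: less_imp_le)
    also have "\<dots> = 2 * B / sqrt (real N)" by simp
    also have "\<dots> \<le> sqrt 2"
    proof -
      have "2 * B = sqrt 2 * sqrt (2 * B\<^sup>2)" using that by (simp add: real_sqrt_mult)
      also have "\<dots> \<le> sqrt 2 * sqrt (real N)" using N by simp
      finally show ?thesis using N(2) by (simp add: field_simps)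
    qed
    finally show ?thesis .
  qed
  define D where "D = 18 * (M N / wallis N + M (Suc N) / wallis (Suc N))"
  define C where "C = (\<Sum>n<N. M n * sqrt (real n)) + D"
  have D: "D \<ge> 0" unfolding D_def using M(1) by (intro mult_nonneg_nonneg add_nonneg_nonneg divide_nonneg_pos) auto
  have C: "D \<le> C" "n < N \<Longrightarrow> M n * sqrt (real n) \<le> C" for n
    using D member_le_sum[of n "{..<N}" "\<lambda>n. M n * sqrt (real n)"] M(1)
    by (auto simp: C_def intro!: sum_nonneg add_increasing2)
  have "(hermite n x)\<^sup>2 \<le> C / sqrt (real n)" if "n \<ge> 1" "\<bar>x\<bar> \<le> B" for n x
  proof (cases "n < N")
    case True
    have "(hermite n x)\<^sup>2 \<le> M n" using M(2) that by blast
    also have "\<dots> \<le> C / sqrt (real n)" using C(2)[OF True] that by (simp add: field_simps)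
    finally show ?thesis .
  next
    case False
    have "(hermite n x)\<^sup>2 \<le>
       9 * wallis n * ((hermite N x)\<^sup>2 / wallis N + (hermite (Suc N) x)\<^sup>2 / wallis (Suc N))"
      using False small[OF that(2)] by (intro hermite_tail_bound) auto
    also have "\<dots> \<le> 9 * (2 / sqrt (real n)) * (M N / wallis N + M (Suc N) / wallis (Suc N))"
      using wallis_le[OF that(1)] M that(2)
      by (intro mult_mono add_mono divide_right_mono add_nonneg_nonneg) (auto simp: less_imp_le)
    also have "\<dots> = D / sqrt (real n)" by (simp add: D_def)
    also have "\<dots> \<le> C / sqrt (real n)" using C(1) by (intro divide_right_mono) auto
    finally show ?thesis .
  qed
  moreover have "C / sqrt (real n) = C * real n powr (-1/2)" if "n \<ge> 1" for n :: nat
    using that by (simp add: powr_minus powr_half_sqrt field_simps)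
  ultimately show ?thesis
    using C(1) D by (intro exI[of _ C]) auto
qed

section \<open>Convergence of the kernel series\<close>

lemma kernel_terms_nonneg:
  assumes "\<And>\<nu>. 0 < \<alpha> \<nu> j"
  shows "0 \<le> inverse (\<alpha> \<nu> j) * hermite \<nu> x * hermite \<nu> x"
  using assms[of \<nu>] by (simp add: mult.assoc less_imp_le)

text \<open>
  The decay of \<open>h\<^sub>n(x)\<^sup>2\<close> is exactly the factor \<open>\<nu>\<^bsup>-1/2\<^esup>\<close> that the summability condition on the
  weights provides.
\<close>

lemma kernel_terms_summable:
  assumes pos: "\<And>\<nu>. 0 < \<alpha> \<nu> j" and i: "weights_summable \<alpha>" and j: "1 \<le> j"
  shows "(\<lambda>\<nu>. inverse (\<alpha> \<nu> j) * hermite \<nu> x * hermite \<nu> x) summable_on {1..}"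
proof -
  obtain C where C: "\<And>n. n \<ge> 1 \<Longrightarrow> (hermite n x)\<^sup>2 \<le> C * real n powr (-1/2)"
    using hermite_sq_le_powr[of "\<bar>x\<bar>"] by blast
  have "(\<lambda>\<nu>. C * (inverse (\<alpha> \<nu> j) * real \<nu> powr (-1/2))) summable_on {1..}"
    using i j unfolding weights_summable_def by (intro summable_on_cmult_right) auto
  then show ?thesis
  proof (rule summable_on_comparison_test)
    fix \<nu> :: nat assume "\<nu> \<in> {1..}"
    then show "inverse (\<alpha> \<nu> j) * hermite \<nu> x * hermite \<nu> x
        \<le> C * (inverse (\<alpha> \<nu> j) * real \<nu> powr (-1/2))"
      using mult_left_mono[OF C, of \<nu> "inverse (\<alpha> \<nu> j)"] pos[of \<nu>]
      by (simp add: power2_eq_square mult_ac less_imp_le)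
  qed (rule kernel_terms_nonneg[of \<alpha>, OF pos])
qed

lemma kernel_star_nonneg:
  assumes "\<And>\<nu>. 0 < \<alpha> \<nu> j"
  shows "0 \<le> kernel_star \<alpha> j x x"
  unfolding kernel_star_def by (intro infsum_nonneg kernel_terms_nonneg assms)

section \<open>Weighted power sums on the domain\<close>

text \<open>
  Induction on \<open>n\<close>: by the recurrence, \<open>x\<close> times \<open>h\<^sub>\<mu>\<close> is a combination of \<open>h\<^sub>\<mu>\<^sub>+\<^sub>1\<close> and
  \<open>h\<^sub>\<mu>\<^sub>-\<^sub>1\<close>, so \<open>x\<^sup>2\<close> times a partial sum is bounded by a multiple of the next one. The case
  \<open>\<mu> = 1\<close> is separate: there the combination contains the constant \<open>h\<^sub>0 = 1\<close>, which the sum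
  from \<open>1\<close> on cannot control near the origin, and the term \<open>h\<^sub>1\<^sup>2 = x\<^sup>2\<close> has to be used instead.
\<close>

lemma power_le_sum_hermite_sq:
  "\<exists>C\<ge>0. \<forall>x. x ^ (2 * Suc n) \<le> C * (\<Sum>\<mu>=1..Suc n. (hermite \<mu> x)\<^sup>2)"
proof -
  define S where "S n x = (\<Sum>\<mu>=1..n. (hermite \<mu> x)\<^sup>2)" for n :: nat and x
  have S_nonneg: "0 \<le> S n x" for n x by (simp add: S_def sum_nonneg)
  have S_ge: "(hermite \<mu> x)\<^sup>2 \<le> S n x" if "1 \<le> \<mu>" "\<mu> \<le> n" for \<mu> n x
    unfolding S_def using that by (intro member_le_sum) auto
  have one: "x\<^sup>2 * (hermite (Suc 0) x)\<^sup>2 \<le> 2 * (hermite (Suc 0) x)\<^sup>2 + 8 * (hermite 2 x)\<^sup>2" for x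
  proof -
    have h2: "(hermite 2 x)\<^sup>2 = (x\<^sup>2 - 1)\<^sup>2 / 2"
    proof -
      have "sqrt 2 * hermite 2 x = x\<^sup>2 - 1"
        using hermite_recurrence[of 0 x] by (simp add: power2_eq_square numeral_2_eq_2)
      then have "(sqrt 2 * hermite 2 x)\<^sup>2 = (x\<^sup>2 - 1)\<^sup>2" by simp
      then show ?thesis by (simp add: power_mult_distrib)
    qed
    \<comment> \<open>The difference of the two sides is \<open>3 (x\<^sup>2 - 1)\<^sup>2 + 1\<close>.\<close>
    have "x\<^sup>2 * x\<^sup>2 \<le> 2 * x\<^sup>2 + 4 * (x\<^sup>2 - 1)\<^sup>2"
      using zero_le_power2[of "x\<^sup>2 - 1"] by (simp add: power2_eq_square algebra_simps)
    then show ?thesis by (simp add: h2)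
  qed
  \<comment> \<open>Square the recurrence and use \<open>(u + v)\<^sup>2 \<le> 2 (u\<^sup>2 + v\<^sup>2)\<close>.\<close>
  have two: "x\<^sup>2 * (hermite (\<mu> + 1) x)\<^sup>2
      \<le> 2 * ((real \<mu> + 2) * (hermite (\<mu> + 2) x)\<^sup>2 + (real \<mu> + 1) * (hermite \<mu> x)\<^sup>2)" for \<mu> x
  proof -
    define u v where "u = sqrt (real \<mu> + 2) * hermite (\<mu> + 2) x"
      and "v = sqrt (real \<mu> + 1) * hermite \<mu> x"
    have "x * hermite (\<mu> + 1) x = u + v"
      using hermite_recurrence[of \<mu> x] by (simp add: u_def v_def)
    then have "x\<^sup>2 * (hermite (\<mu> + 1) x)\<^sup>2 = (u + v)\<^sup>2"
      by (metis power_mult_distrib)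
    also have "\<dots> \<le> 2 * (u\<^sup>2 + v\<^sup>2)"
      using sum_squares_bound[of u v] by (simp add: power2_sum)
    finally show ?thesis by (simp add: u_def v_def power_mult_distrib)
  qed
  have each: "x\<^sup>2 * (hermite \<mu> x)\<^sup>2 \<le> (10 + 4 * real n) * S (Suc n) x"
    if \<mu>: "1 \<le> \<mu>" "\<mu> \<le> n" for \<mu> n x
  proof (cases "\<mu> = 1")
    case True
    have "x\<^sup>2 * (hermite \<mu> x)\<^sup>2 \<le> 2 * S (Suc n) x + 8 * S (Suc n) x"
      using one[of x] S_ge[of 1 "Suc n" x] S_ge[of 2 "Suc n" x] \<mu> True by simp
    also have "\<dots> \<le> (10 + 4 * real n) * S (Suc n) x"
      using S_nonneg[of "Suc n" x] by (simp add: algebra_simps)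
    finally show ?thesis .
  next
    case False
    define k where "k = \<mu> - 1"
    have k: "\<mu> = k + 1" "1 \<le> k" "k + 2 \<le> Suc n" using \<mu> False by (auto simp: k_def)
    have "x\<^sup>2 * (hermite \<mu> x)\<^sup>2 \<le>
        2 * ((real k + 2) * (hermite (k + 2) x)\<^sup>2 + (real k + 1) * (hermite k x)\<^sup>2)"
      unfolding k(1) by (rule two)
    also have "\<dots> \<le> 2 * ((real k + 2) * S (Suc n) x + (real k + 1) * S (Suc n) x)"
      using k by (intro mult_left_mono add_mono S_ge) auto
    also have "\<dots> = (4 * real k + 6) * S (Suc n) x" by (simp add: algebra_simps)
    also have "\<dots> \<le> (10 + 4 * real n) * S (Suc n) x"
      using k by (intro mult_right_mono S_nonneg) auto
    finally show ?thesis .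
  qed
  have "\<exists>C\<ge>0. \<forall>x. x ^ (2 * Suc n) \<le> C * S (Suc n) x"
  proof (induction n)
    case 0
    show ?case by (intro exI[of _ 1]) (simp add: S_def power2_eq_square)
  next
    case (Suc n)
    then obtain C where C: "C \<ge> 0" "\<And>x. x ^ (2 * Suc n) \<le> C * S (Suc n) x" by blast
    define D where "D = real (Suc n) * (10 + 4 * real (Suc n))"
    have "x ^ (2 * Suc (Suc n)) \<le> C * D * S (Suc (Suc n)) x" for x
    proof -
      have "x\<^sup>2 * S (Suc n) x = (\<Sum>\<mu>=1..Suc n. x\<^sup>2 * (hermite \<mu> x)\<^sup>2)"
        unfolding S_def by (rule sum_distrib_left)
      also have "\<dots> \<le> (\<Sum>\<mu>=1..Suc n. (10 + 4 * real (Suc n)) * S (Suc (Suc n)) x)"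
        by (intro sum_mono each) auto
      also have "\<dots> = D * S (Suc (Suc n)) x" by (simp add: D_def)
      finally have D: "x\<^sup>2 * S (Suc n) x \<le> D * S (Suc (Suc n)) x" .
      have "x ^ (2 * Suc (Suc n)) = x\<^sup>2 * x ^ (2 * Suc n)"
        by (simp flip: power_add)
      also have "\<dots> \<le> x\<^sup>2 * (C * S (Suc n) x)"
        by (intro mult_left_mono C) auto
      also have "\<dots> = C * (x\<^sup>2 * S (Suc n) x)" by simp
      also have "\<dots> \<le> C * (D * S (Suc (Suc n)) x)"
        by (intro mult_left_mono D C)
      finally show ?thesis by (simp add: mult.assoc)
    qed
    moreover have "C * D \<ge> 0" using C(1) by (simp add: D_def)
    ultimately show ?case by blast
  qed
  then show ?thesis by (simp add: S_def)
qed

lemma kernel_domain_subset_weighted_ell_even: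
  assumes pos: "\<And>\<nu> j. 1 \<le> j \<Longrightarrow> 0 < \<alpha> \<nu> j"
    and i: "weights_summable \<alpha>"
    and mono: "\<And>\<nu> j. 1 \<le> \<nu> \<Longrightarrow> 1 \<le> j \<Longrightarrow> \<alpha> \<nu> j \<le> \<alpha> (\<nu> + 1) j"
    and \<nu>: "1 \<le> \<nu>"
  shows "kernel_domain \<alpha> \<subseteq> weighted_ell_even \<nu> (\<lambda>j. inverse (\<alpha> \<nu> j))"
proof
  fix x assume "x \<in> kernel_domain \<alpha>"
  then have x: "x \<in> real_seqs" "(\<lambda>j. kernel_star \<alpha> j (x j) (x j)) summable_on {1..}"
    by (auto simp: kernel_domain_def)
  have mono': "\<alpha> \<mu> j \<le> \<alpha> \<nu> j" if "1 \<le> \<mu>" "\<mu> \<le> \<nu>" "1 \<le> j" for \<mu> j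
    using that(2)
  proof (induction \<nu> rule: dec_induct)
    case (step n)
    then show ?case using mono[of n j] that by simp
  qed simp
  obtain C where C: "C \<ge> 0" "\<And>y. y ^ (2 * \<nu>) \<le> C * (\<Sum>\<mu>=1..\<nu>. (hermite \<mu> y)\<^sup>2)"
    using power_le_sum_hermite_sq[of "\<nu> - 1"] \<nu> by auto
  have "(\<lambda>j. C * kernel_star \<alpha> j (x j) (x j)) summable_on {1..}"
    by (intro summable_on_cmult_right x)
  then have "(\<lambda>j. inverse (\<alpha> \<nu> j) * x j ^ (2 * \<nu>)) summable_on {1..}"
  proof (rule summable_on_comparison_test)
    fix j :: nat assume "j \<in> {1..}"
    then have j: "1 \<le> j" by simp
    note pos_j = pos[OF j]
    have "inverse (\<alpha> \<nu> j) * x j ^ (2 * \<nu>)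
        \<le> inverse (\<alpha> \<nu> j) * (C * (\<Sum>\<mu>=1..\<nu>. (hermite \<mu> (x j))\<^sup>2))"
      using C(2) pos_j[of \<nu>] by (intro mult_left_mono) (auto simp: less_imp_le)
    also have "\<dots> = C * (\<Sum>\<mu>=1..\<nu>. inverse (\<alpha> \<nu> j) * (hermite \<mu> (x j))\<^sup>2)"
      by (simp add: sum_distrib_left mult_ac)
    also have "\<dots> \<le> C * (\<Sum>\<mu>=1..\<nu>. inverse (\<alpha> \<mu> j) * hermite \<mu> (x j) * hermite \<mu> (x j))"
      unfolding power2_eq_square mult.assoc using C(1) pos_j mono' j
      by (intro mult_left_mono sum_mono mult_right_mono le_imp_inverse_le) auto
    also have "\<dots> \<le> C * kernel_star \<alpha> j (x j) (x j)"
      unfolding kernel_star_def using C(1) pos_j i j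
      by (intro mult_left_mono finite_sum_le_infsum kernel_terms_summable kernel_terms_nonneg) auto
    finally show "inverse (\<alpha> \<nu> j) * x j ^ (2 * \<nu>) \<le> C * kernel_star \<alpha> j (x j) (x j)" .
    show "0 \<le> inverse (\<alpha> \<nu> j) * x j ^ (2 * \<nu>)"
      using pos_j[of \<nu>] by (simp add: power_mult less_imp_le)
  qed
  with x show "x \<in> weighted_ell_even \<nu> (\<lambda>j. inverse (\<alpha> \<nu> j))"
    by (simp add: weighted_ell_even_def)
qed

lemma ex_real_seq_notin_weighted_ell_even:
  assumes pos: "\<And>j. 1 \<le> j \<Longrightarrow> 0 < w j"
  shows "\<exists>x\<in>real_seqs. x \<notin> weighted_ell_even 1 w"
proof
  define x where "x j = (if 1 \<le> j then sqrt (inverse (w j)) else undefined)" for j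
  show "x \<in> real_seqs" by (auto simp: x_def real_seqs_def PiE_def extensional_def)
  have "w j * x j ^ (2 * 1) = 1" if "1 \<le> j" for j
    using pos[OF that] that by (simp add: x_def less_imp_le)
  then have "(\<lambda>j. w j * x j ^ (2 * 1)) summable_on {1..} \<longleftrightarrow> (\<lambda>j::nat. 1::real) summable_on {1..}"
    by (intro summable_on_cong) auto
  also have "\<dots> \<longleftrightarrow> False"
    by (subst summable_on_atLeast_iff) (auto simp: summable_const_iff)
  finally show "x \<notin> weighted_ell_even 1 w"
    by (simp add: weighted_ell_even_def)
qed

section \<open>Bounded sequences and the domain\<close>

text \<open>
  On a bounded set the squares of all Hermite polynomials of positive degree share one upper bound,
  which can be taken out of the kernel series.
\<close>

lemma kernel_star_le_weight_sum:
  fixes J :: "nat set"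
  assumes pos: "\<And>\<nu> j. j \<in> J \<Longrightarrow> 0 < \<alpha> \<nu> j"
    and sum: "\<And>j. j \<in> J \<Longrightarrow> (\<lambda>\<nu>. inverse (\<alpha> \<nu> j)) summable_on {1..}"
  shows "\<exists>C\<ge>0. \<forall>j\<in>J. \<forall>x. \<bar>x\<bar> \<le> B \<longrightarrow> kernel_star \<alpha> j x x \<le> C * (\<Sum>\<^sub>\<infinity>\<nu>\<in>{1..}. inverse (\<alpha> \<nu> j))"
proof -
  obtain C where C: "C \<ge> 0" "\<And>n x. n \<ge> 1 \<Longrightarrow> \<bar>x\<bar> \<le> B \<Longrightarrow> (hermite n x)\<^sup>2 \<le> C * real n powr (-1/2)"
    using hermite_sq_le_powr[of B] by blast
  have C1: "hermite n x * hermite n x \<le> C" if "n \<ge> 1" "\<bar>x\<bar> \<le> B" for n x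
  proof -
    have "real n powr (-1/2) \<le> real n powr 0" using that by (intro powr_mono) auto
    also have "\<dots> = 1" using that by simp
    finally have "C * real n powr (-1/2) \<le> C * 1" by (rule mult_left_mono) (rule C(1))
    with C(2)[OF that] show ?thesis by (simp add: power2_eq_square)
  qed
  have "kernel_star \<alpha> j x x \<le> C * (\<Sum>\<^sub>\<infinity>\<nu>\<in>{1..}. inverse (\<alpha> \<nu> j))" if j: "j \<in> J" and x: "\<bar>x\<bar> \<le> B" for j x
  proof -
    have summ: "(\<lambda>\<nu>. C * inverse (\<alpha> \<nu> j)) summable_on {1..}"
      by (intro summable_on_cmult_right sum j)
    have le: "inverse (\<alpha> \<nu> j) * hermite \<nu> x * hermite \<nu> x \<le> C * inverse (\<alpha> \<nu> j)" if "\<nu> \<in> {1..}" for \<nu>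
      using mult_left_mono[OF C1[of \<nu> x], of "inverse (\<alpha> \<nu> j)"] that x pos[OF j, of \<nu>]
      by (simp add: mult_ac less_imp_le)
    have "(\<lambda>\<nu>. inverse (\<alpha> \<nu> j) * hermite \<nu> x * hermite \<nu> x) summable_on {1..}"
      by (rule summable_on_comparison_test[OF summ le]) (auto intro!: kernel_terms_nonneg pos j)
    then have "kernel_star \<alpha> j x x \<le> (\<Sum>\<^sub>\<infinity>\<nu>\<in>{1..}. C * inverse (\<alpha> \<nu> j))"
      unfolding kernel_star_def using summ le by (rule infsum_mono)
    then show ?thesis by (simp add: infsum_cmult_right')
  qed
  with C(1) show ?thesis by blast
qed

lemma summable_tail_in_kernel_domain:
  assumes "x \<in> real_seqs" and "(\<lambda>j. kernel_star \<alpha> j (x j) (x j)) summable_on {m..}"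
  shows "x \<in> kernel_domain \<alpha>"
  using assms summable_on_atLeast_change_start by (auto simp: kernel_domain_def)

text \<open>
  A bounded sequence has kernel values at most a constant times the summable weight sums. For
  strictness, the positions \<open>f n\<close> carry the value \<open>n\<close> and are chosen so far out that the kernel
  there is at most \<open>2\<^bsup>-n\<^esup>\<close>.
\<close>

lemma ell_infinity_psubset_kernel_domain:
  assumes pos: "\<And>\<nu> j. 1 \<le> j \<Longrightarrow> 0 < \<alpha> \<nu> j" and j0: "1 \<le> j0"
    and sum: "\<And>j. j0 \<le> j \<Longrightarrow> (\<lambda>\<nu>. inverse (\<alpha> \<nu> j)) summable_on {1..}"
    and sum': "(\<lambda>j. \<Sum>\<^sub>\<infinity>\<nu>\<in>{1..}. inverse (\<alpha> \<nu> j)) summable_on {j0..}"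
  shows "ell_infinity \<subset> kernel_domain \<alpha>"
proof
  define s where "s j = (\<Sum>\<^sub>\<infinity>\<nu>\<in>{1..}. inverse (\<alpha> \<nu> j))" for j
  have s_nonneg: "0 \<le> s j" if "j0 \<le> j" for j
    unfolding s_def using pos j0 that by (intro infsum_nonneg) (auto simp: less_imp_le)
  have K_nonneg: "0 \<le> kernel_star \<alpha> j x x" if "j0 \<le> j" for j x
    using kernel_star_nonneg[of \<alpha> j x] pos j0 that by auto
  have bound: "\<exists>C\<ge>0. \<forall>j\<ge>j0. \<forall>x. \<bar>x\<bar> \<le> B \<longrightarrow> kernel_star \<alpha> j x x \<le> C * s j" for B
    using kernel_star_le_weight_sum[of "{j0..}" \<alpha> B] pos sum j0 by (auto simp: s_def)
  show "ell_infinity \<subseteq> kernel_domain \<alpha>"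
  proof
    fix x assume "x \<in> ell_infinity"
    then obtain B where x: "x \<in> real_seqs" and B: "\<And>j. 1 \<le> j \<Longrightarrow> \<bar>x j\<bar> \<le> B"
      by (auto simp: ell_infinity_def bounded_iff)
    obtain C where C: "\<And>j x. j0 \<le> j \<Longrightarrow> \<bar>x\<bar> \<le> B \<Longrightarrow> kernel_star \<alpha> j x x \<le> C * s j"
      using bound[of B] by blast
    have "(\<lambda>j. C * s j) summable_on {j0..}"
      using sum' unfolding s_def by (rule summable_on_cmult_right)
    then have "(\<lambda>j. kernel_star \<alpha> j (x j) (x j)) summable_on {j0..}"
      by (rule summable_on_comparison_test) (use j0 in \<open>auto intro!: C B K_nonneg\<close>)
    with x show "x \<in> kernel_domain \<alpha>"
      by (rule summable_tail_in_kernel_domain)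
  qed
  have s_lim: "s \<longlonglongrightarrow> 0"
  proof -
    have "summable (\<lambda>n. s (n + j0))"
      using sum' s_nonneg unfolding s_def by (subst summable_on_atLeast_iff[symmetric])
    then have "(\<lambda>n. s (n + j0)) \<longlonglongrightarrow> 0" by (rule summable_LIMSEQ_zero)
    then show ?thesis by (rule LIMSEQ_offset)
  qed
  have small: "\<exists>j>k. j0 \<le> j \<and> kernel_star \<alpha> j (real n) (real n) \<le> (1/2) ^ n" for k n
  proof -
    obtain C where C: "\<And>j x. j0 \<le> j \<Longrightarrow> \<bar>x\<bar> \<le> real n \<Longrightarrow> kernel_star \<alpha> j x x \<le> C * s j"
      using bound[of "real n"] by blast
    have "(\<lambda>j. C * s j) \<longlonglongrightarrow> 0" using tendsto_mult_right_zero[OF s_lim] .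
    then have "eventually (\<lambda>j. C * s j < (1/2) ^ n) sequentially"
      by (rule order_tendstoD(2)) simp
    then have "eventually (\<lambda>j. k < j \<and> j0 \<le> j \<and> C * s j < (1/2) ^ n) sequentially"
      by (intro eventually_conj eventually_gt_at_top eventually_ge_at_top)
    then obtain j where "k < j" "j0 \<le> j" "C * s j < (1/2) ^ n"
      using eventually_happens'[OF sequentially_bot] by blast
    with C[of j "real n"] show ?thesis by (intro exI[of _ j]) auto
  qed
  have "\<exists>f. \<forall>n. (j0 \<le> f n \<and> kernel_star \<alpha> (f n) (real n) (real n) \<le> (1/2) ^ n) \<and> f n < f (Suc n)"
    by (rule dependent_nat_choice) (use small in blast)+
  then obtain f where f: "\<And>n. j0 \<le> f n" "\<And>n. kernel_star \<alpha> (f n) (real n) (real n) \<le> (1/2) ^ n"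
    and "strict_mono f" by (auto simp: strict_mono_Suc_iff)
  then have inj: "inj f" by (intro strict_mono_imp_inj_on)
  define x where "x j = (if j \<in> range f then real (inv f j) else if 1 \<le> j then 0 else undefined)" for j
  have x_f: "x (f n) = real n" for n by (simp add: x_def inj)
  have x_seq: "x \<in> real_seqs"
    using f(1) j0 by (auto simp: x_def real_seqs_def PiE_def extensional_def) (metis le_trans not_less_eq_eq)
  have "x \<notin> ell_infinity"
  proof
    assume "x \<in> ell_infinity"
    then obtain B where "\<And>j. 1 \<le> j \<Longrightarrow> \<bar>x j\<bar> \<le> B"
      by (auto simp: ell_infinity_def bounded_iff)
    then have "real n \<le> B" for n
      using x_f[of n] order.trans[OF j0 f(1)[of n]] by (metis abs_of_nat)
    then show False using reals_Archimedean2[of B] by (auto simp: not_less[symmetric])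
  qed
  moreover have "x \<in> kernel_domain \<alpha>"
  proof (rule summable_tail_in_kernel_domain[OF x_seq])
    let ?K = "\<lambda>j. kernel_star \<alpha> j (x j) (x j)"
    have "(\<lambda>n. (1/2::real) ^ n) summable_on UNIV"
      by (intro summable_nonneg_imp_summable_on summable_geometric) auto
    then have "(?K \<circ> f) summable_on UNIV"
      by (rule summable_on_comparison_test) (use f K_nonneg in \<open>auto simp: x_f\<close>)
    then have "?K summable_on range f"
      by (simp add: summable_on_reindex[OF inj])
    moreover have "?K summable_on ({j0..} - range f)"
    proof -
      obtain C where C: "\<And>j x. j0 \<le> j \<Longrightarrow> \<bar>x\<bar> \<le> 0 \<Longrightarrow> kernel_star \<alpha> j x x \<le> C * s j"
        using bound[of 0] by blast
      have "(\<lambda>j. C * s j) summable_on {j0..}"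
        using sum' unfolding s_def by (rule summable_on_cmult_right)
      then have "(\<lambda>j. C * s j) summable_on ({j0..} - range f)"
        by (rule summable_on_subset_banach) auto
      then show ?thesis
        by (rule summable_on_comparison_test) (use j0 in \<open>auto intro!: C K_nonneg simp: x_def\<close>)
    qed
    ultimately have "?K summable_on (range f \<union> ({j0..} - range f))"
      by (intro summable_on_Un_disjoint) auto
    also have "range f \<union> ({j0..} - range f) = {j0..}" using f(1) by auto
    finally show "?K summable_on {j0..}" .
  qed
  ultimately show "ell_infinity \<noteq> kernel_domain \<alpha>" by blast
qed

section \<open>The Gaussian measure of the domain\<close>

lemma kernel_star_sums:
  assumes "\<And>\<nu>. 0 < \<alpha> \<nu> j" "weights_summable \<alpha>" "1 \<le> j"
  shows "(\<lambda>n. inverse (\<alpha> (Suc n) j) * (hermite (Suc n) x)\<^sup>2) sums kernel_star \<alpha> j x x"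
  using infsum_atLeast_sums[OF kernel_terms_summable[OF assms, of x]]
  by (simp add: kernel_star_def power2_eq_square mult.assoc)

lemma borel_measurable_kernel_star:
  assumes "\<And>\<nu>. 0 < \<alpha> \<nu> j" "weights_summable \<alpha>" "1 \<le> j"
  shows "(\<lambda>x. kernel_star \<alpha> j x x) \<in> borel_measurable borel"
proof -
  have "(\<lambda>x. kernel_star \<alpha> j x x) = (\<lambda>x. \<Sum>n. inverse (\<alpha> (Suc n) j) * (hermite (Suc n) x)\<^sup>2)"
    using sums_unique[OF kernel_star_sums[OF assms]] by (rule ext)
  then show ?thesis by simp
qed

lemma nn_integral_kernel_star:
  assumes pos: "\<And>\<nu>. 0 < \<alpha> \<nu> j" and "weights_summable \<alpha>" "1 \<le> j"
    and sum: "(\<lambda>\<nu>. inverse (\<alpha> \<nu> j)) summable_on {1..}"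
  shows "(\<integral>\<^sup>+x. ennreal (kernel_star \<alpha> j x x) \<partial>std_gauss) = ennreal (\<Sum>\<^sub>\<infinity>\<nu>\<in>{1..}. inverse (\<alpha> \<nu> j))"
proof -
  have pos': "0 \<le> inverse (\<alpha> n j)" for n using pos[of n] by simp
  have "ennreal (kernel_star \<alpha> j x x)
      = (\<Sum>n. ennreal (inverse (\<alpha> (Suc n) j)) * ennreal ((hermite (Suc n) x)\<^sup>2))" for x
  proof -
    have "(\<Sum>n. ennreal (inverse (\<alpha> (Suc n) j) * (hermite (Suc n) x)\<^sup>2)) = ennreal (kernel_star \<alpha> j x x)"
      using pos' kernel_star_sums[OF assms(1-3), of x] by (intro suminf_ennreal_eq) simp_all
    with pos' show ?thesis by (simp add: ennreal_mult)
  qed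
  then have "(\<integral>\<^sup>+x. ennreal (kernel_star \<alpha> j x x) \<partial>std_gauss)
      = (\<Sum>n. ennreal (inverse (\<alpha> (Suc n) j)) * (\<integral>\<^sup>+x. ennreal ((hermite (Suc n) x)\<^sup>2) \<partial>std_gauss))"
    by (simp add: nn_integral_suminf nn_integral_cmult)
  also have "\<dots> = ennreal (\<Sum>\<^sub>\<infinity>\<nu>\<in>{1..}. inverse (\<alpha> \<nu> j))"
    unfolding nn_integral_hermite_sq mult_1_right
    using pos' infsum_atLeast_sums[OF sum] by (intro suminf_ennreal_eq) simp_all
  finally show ?thesis .
qed

lemma prob_space_std_gauss: "prob_space std_gauss"
  by (rule prob_space_normal_density) simp

lemma nn_integral_gauss_product_component:
  assumes "g \<in> borel_measurable borel" and "1 \<le> j"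
  shows "(\<integral>\<^sup>+x. g (x j) \<partial>gauss_product) = (\<integral>\<^sup>+y. g y \<partial>std_gauss)"
proof -
  have "std_gauss = distr gauss_product std_gauss (\<lambda>x. x j)"
    unfolding gauss_product_def using assms prob_space_std_gauss
    by (intro distr_PiM_component[symmetric]) auto
  then have "(\<integral>\<^sup>+y. g y \<partial>std_gauss) = (\<integral>\<^sup>+y. g y \<partial>distr gauss_product std_gauss (\<lambda>x. x j))"
    by simp
  also have "\<dots> = (\<integral>\<^sup>+x. g (x j) \<partial>gauss_product)"
    unfolding gauss_product_def using assms by (intro nn_integral_distr) auto
  finally show ?thesis by simp
qed

lemma measurable_gauss_product_component:
  assumes "1 \<le> j"
  shows "(\<lambda>x. x j) \<in> borel_measurable gauss_product"
proof -
  have "(\<lambda>x. x j) \<in> measurable gauss_product std_gauss"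
    unfolding gauss_product_def using assms by (intro measurable_component_singleton) auto
  then show ?thesis by simp
qed

text \<open>
  By monotone convergence the sum of the kernels over \<open>j \<ge> j0\<close> has finite expectation, so it is
  almost surely finite; the finitely many coordinates before \<open>j0\<close> do not affect summability.
\<close>

lemma emeasure_kernel_domain:
  assumes pos: "\<And>\<nu> j. 1 \<le> j \<Longrightarrow> 0 < \<alpha> \<nu> j" and i: "weights_summable \<alpha>" and j0: "1 \<le> j0"
    and sum: "\<And>j. j0 \<le> j \<Longrightarrow> (\<lambda>\<nu>. inverse (\<alpha> \<nu> j)) summable_on {1..}"
    and sum': "(\<lambda>j. \<Sum>\<^sub>\<infinity>\<nu>\<in>{1..}. inverse (\<alpha> \<nu> j)) summable_on {j0..}"
  shows "emeasure gauss_product (kernel_domain \<alpha>) = 1"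
proof -
  have K_meas: "(\<lambda>x. kernel_star \<alpha> j (x j) (x j)) \<in> borel_measurable gauss_product" if "1 \<le> j" for j
    using measurable_compose[OF measurable_gauss_product_component[OF that]
        borel_measurable_kernel_star[of \<alpha> j, OF pos[OF that] i that]] .
  have K_nonneg: "0 \<le> kernel_star \<alpha> j x x" if "1 \<le> j" for j x
    using kernel_star_nonneg[of \<alpha> j x] pos that by auto
  define S where "S x = (\<Sum>n. ennreal (kernel_star \<alpha> (n + j0) (x (n + j0)) (x (n + j0))))" for x
  have S_meas [measurable]: "S \<in> borel_measurable gauss_product"
    unfolding S_def using j0 K_meas by (intro borel_measurable_suminf_order measurable_compose[OF _ measurable_ennreal]) auto
  have domain: "x \<in> kernel_domain \<alpha> \<longleftrightarrow> S x \<noteq> \<infinity>" if x: "x \<in> real_seqs" for x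
  proof -
    let ?K = "\<lambda>j. kernel_star \<alpha> j (x j) (x j)"
    have "x \<in> kernel_domain \<alpha> \<longleftrightarrow> ?K summable_on {j0..}"
    proof
      assume "x \<in> kernel_domain \<alpha>"
      then have "?K summable_on {1..}" by (simp add: kernel_domain_def)
      then show "?K summable_on {j0..}" by (rule summable_on_atLeast_change_start)
    qed (rule summable_tail_in_kernel_domain[OF x])
    also have "\<dots> \<longleftrightarrow> summable (\<lambda>n. ?K (n + j0))"
      using j0 by (intro summable_on_atLeast_iff K_nonneg) auto
    also have "\<dots> \<longleftrightarrow> S x \<noteq> \<infinity>"
    proof
      assume "summable (\<lambda>n. ?K (n + j0))"
      then show "S x \<noteq> \<infinity>"
        unfolding S_def using j0 K_nonneg by (subst suminf_ennreal2) auto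
    next
      assume "S x \<noteq> \<infinity>"
      then show "summable (\<lambda>n. ?K (n + j0))"
        unfolding S_def using j0 K_nonneg by (intro summable_suminf_not_top) auto
    qed
    finally show ?thesis .
  qed
  have set_eq: "kernel_domain \<alpha> = {x \<in> space gauss_product. S x \<noteq> \<infinity>}"
    using domain by (auto simp: space_gauss_product kernel_domain_def)
  interpret prob_space gauss_product
    unfolding gauss_product_def by (intro prob_space_PiM prob_space_std_gauss)
  have "(\<integral>\<^sup>+x. S x \<partial>gauss_product)
      = (\<Sum>n. \<integral>\<^sup>+x. ennreal (kernel_star \<alpha> (n + j0) (x (n + j0)) (x (n + j0))) \<partial>gauss_product)"
    unfolding S_def using j0 K_meas by (intro nn_integral_suminf measurable_compose[OF _ measurable_ennreal]) auto
  also have "\<dots> = (\<Sum>n. ennreal (\<Sum>\<^sub>\<infinity>\<nu>\<in>{1..}. inverse (\<alpha> \<nu> (n + j0))))"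
  proof (intro suminf_cong)
    fix n
    have j: "1 \<le> n + j0" using j0 by simp
    have "(\<integral>\<^sup>+x. ennreal (kernel_star \<alpha> (n + j0) (x (n + j0)) (x (n + j0))) \<partial>gauss_product)
        = (\<integral>\<^sup>+y. ennreal (kernel_star \<alpha> (n + j0) y y) \<partial>std_gauss)"
      using borel_measurable_kernel_star[of \<alpha> "n + j0", OF pos[OF j] i j] j
      by (intro nn_integral_gauss_product_component[where g = "\<lambda>y. ennreal (kernel_star \<alpha> (n + j0) y y)"]
            measurable_compose[OF _ measurable_ennreal])
    also have "\<dots> = ennreal (\<Sum>\<^sub>\<infinity>\<nu>\<in>{1..}. inverse (\<alpha> \<nu> (n + j0)))"
      using pos[OF j] i j sum by (intro nn_integral_kernel_star) auto
    finally show "(\<integral>\<^sup>+x. ennreal (kernel_star \<alpha> (n + j0) (x (n + j0)) (x (n + j0))) \<partial>gauss_product)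
        = ennreal (\<Sum>\<^sub>\<infinity>\<nu>\<in>{1..}. inverse (\<alpha> \<nu> (n + j0)))" .
  qed
  also have "\<dots> = ennreal (\<Sum>\<^sub>\<infinity>j\<in>{j0..}. \<Sum>\<^sub>\<infinity>\<nu>\<in>{1..}. inverse (\<alpha> \<nu> j))"
  proof (rule suminf_ennreal_eq)
    show "0 \<le> (\<Sum>\<^sub>\<infinity>\<nu>\<in>{1..}. inverse (\<alpha> \<nu> (n + j0)))" for n
      using pos[of "n + j0"] j0 by (intro infsum_nonneg) (simp add: less_imp_le)
  qed (rule infsum_atLeast_sums[OF sum'])
  finally have "AE x in gauss_product. S x \<noteq> \<infinity>"
    by (intro nn_integral_PInf_AE S_meas) simp
  then have "AE x in gauss_product. x \<in> kernel_domain \<alpha>"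
    unfolding set_eq by (rule AE_mp) (auto intro!: AE_I2)
  then show ?thesis
    by (intro emeasure_eq_1_AE) (auto simp: set_eq)
qed

section \<open>The inclusions and the measure of the domain\<close>

theorem proposition3p10:
  fixes \<alpha> :: "nat \<Rightarrow> nat \<Rightarrow> real"
  assumes pos: "\<And>\<nu> j. 1 \<le> j \<Longrightarrow> 0 < \<alpha> \<nu> j"
    and i: "weights_summable \<alpha>"
  shows "((\<forall>\<nu>\<ge>1. \<forall>j\<ge>1. \<alpha> \<nu> j \<le> \<alpha> (\<nu> + 1) j) \<longrightarrow>
            kernel_domain \<alpha> \<subseteq> (\<Inter>\<nu>\<in>{1..}. weighted_ell_even \<nu> (\<lambda>j. inverse (\<alpha> \<nu> j))) \<and>
            (\<Inter>\<nu>\<in>{1..}. weighted_ell_even \<nu> (\<lambda>j. inverse (\<alpha> \<nu> j))) \<subset> real_seqs) \<and>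
         ((\<exists>j0\<ge>1. (\<lambda>(\<nu>, j). inverse (\<alpha> \<nu> j)) summable_on ({1..} \<times> {j0..})) \<longrightarrow>
            emeasure gauss_product (kernel_domain \<alpha>) = 1 \<and>
            ell_infinity \<subset> kernel_domain \<alpha>)"
proof (intro conjI impI)
  assume mono: "\<forall>\<nu>\<ge>1. \<forall>j\<ge>1. \<alpha> \<nu> j \<le> \<alpha> (\<nu> + 1) j"
  show "kernel_domain \<alpha> \<subseteq> (\<Inter>\<nu>\<in>{1..}. weighted_ell_even \<nu> (\<lambda>j. inverse (\<alpha> \<nu> j)))"
    using kernel_domain_subset_weighted_ell_even[OF pos i] mono by blast
  obtain x where "x \<in> real_seqs" "x \<notin> weighted_ell_even 1 (\<lambda>j. inverse (\<alpha> 1 j))"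
    using ex_real_seq_notin_weighted_ell_even[of "\<lambda>j. inverse (\<alpha> 1 j)"] pos by auto
  moreover from this have "x \<notin> (\<Inter>\<nu>\<in>{1..}. weighted_ell_even \<nu> (\<lambda>j. inverse (\<alpha> \<nu> j)))"
    by (meson INT_D atLeast_iff order_refl)
  moreover have "(\<Inter>\<nu>\<in>{1..}. weighted_ell_even \<nu> (\<lambda>j. inverse (\<alpha> \<nu> j))) \<subseteq> real_seqs"
    by (auto simp: weighted_ell_even_def)
  ultimately show "(\<Inter>\<nu>\<in>{1..}. weighted_ell_even \<nu> (\<lambda>j. inverse (\<alpha> \<nu> j))) \<subset> real_seqs"
    by blast
next
  assume "\<exists>j0\<ge>1. (\<lambda>(\<nu>, j). inverse (\<alpha> \<nu> j)) summable_on ({1..} \<times> {j0..})"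
  then obtain j0 where j0: "1 \<le> j0"
    and ii: "(\<lambda>(\<nu>, j). inverse (\<alpha> \<nu> j)) summable_on ({1..} \<times> {j0..})" by blast
  have swap: "(\<lambda>(j, \<nu>). inverse (\<alpha> \<nu> j)) summable_on ({j0..} \<times> {1..})"
    using ii by (subst (asm) summable_on_swap) simp
  have sum: "(\<lambda>\<nu>. inverse (\<alpha> \<nu> j)) summable_on {1..}" if "j0 \<le> j" for j
    using summable_on_SigmaD1[OF swap, of j] that by simp
  have sum': "(\<lambda>j. \<Sum>\<^sub>\<infinity>\<nu>\<in>{1..}. inverse (\<alpha> \<nu> j)) summable_on {j0..}"
    using summable_on_SigmaD[OF swap] sum by simp
  show "emeasure gauss_product (kernel_domain \<alpha>) = 1"
    using pos i j0 sum sum' by (rule emeasure_kernel_domain)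
  show "ell_infinity \<subset> kernel_domain \<alpha>"
    using pos j0 sum sum' by (rule ell_infinity_psubset_kernel_domain)
qed

end
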